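(* Let $k\ge 0$ be an integer. If $G$ is a graph that is $1$-unique and subgraph-critical with tree-depth $k+1$, then $G$ is $(k+1)$-critical.
   Context: Graphs are finite and simple. A $k$-ranking of a graph $G$ is a labeling of $V(G)$ with values from $\{1,\dots,k\}$ such that every path joining two distinct vertices with the same label contains a vertex having a larger label. The tree-depth $\mathrm{td}(G)$ is the smallest $k$ for which $G$ has a $k$-ranking (the graph with no vertices has tree-depth $0$). A ranking of $G$ is optimal if it is a $\mathrm{td}(G)$-ranking. A graph $G$ is subgraph-critical if every proper subgraph of $G$ has tree-depth less than $\mathrm{td}(G)$. A graph is $k$-critical if it has tree-depth $k$ and every proper minor of it has tree-depth less than $k$. A graph $G$ is $1$-unique if for every vertex $v$ of $G$ there is an optimal ranking of $G$ in which $v$ is the only vertex receiving label $1$. *)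

theory Defs
  imports "Graph_Theory.Graph_Theory"
begin

text \<open>
  Finite simple graphs are the library's \<^const>\<open>pair_graph\<close>s: finitely many vertices and a
  symmetric irreflexive set of arcs, the edge \<open>uv\<close> being the pair of arcs \<open>(u, v)\<close>, \<open>(v, u)\<close>.
  The graph without vertices is included.
\<close>

text \<open>
  Labelings are total functions; their values outside \<^term>\<open>pverts G\<close> are irrelevant.
\<close>

definition is_ranking :: "'a pair_pre_digraph \<Rightarrow> nat \<Rightarrow> ('a \<Rightarrow> nat) \<Rightarrow> bool" where
  "is_ranking G k f \<longleftrightarrow>
     (\<forall>v \<in> pverts G. f v \<in> {1..k}) \<and>
     (\<forall>p. vpath p (with_proj G) \<longrightarrow> hd p \<noteq> last p \<longrightarrow> f (hd p) = f (last p) \<longrightarrow>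
        (\<exists>w \<in> set p. f w > f (hd p)))"

definition tree_depth :: "'a pair_pre_digraph \<Rightarrow> nat" where
  "tree_depth G = (LEAST k. \<exists>f. is_ranking G k f)"

definition optimal_ranking :: "'a pair_pre_digraph \<Rightarrow> ('a \<Rightarrow> nat) \<Rightarrow> bool" where
  "optimal_ranking G f \<longleftrightarrow> is_ranking G (tree_depth G) f"

definition one_unique :: "'a pair_pre_digraph \<Rightarrow> bool" where
  "one_unique G \<longleftrightarrow>
     (\<forall>v \<in> pverts G. \<exists>f. optimal_ranking G f \<and> {u \<in> pverts G. f u = 1} = {v})"

text \<open>
  The library's \<^const>\<open>subgraph\<close> is a relation on digraphs, which need not be symmetric, so
  that \<open>H\<close> is required separately to be a graph.
\<close>

definition subgraph_critical :: "'a pair_pre_digraph \<Rightarrow> bool" where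
  "subgraph_critical G \<longleftrightarrow>
     (\<forall>H. pair_graph H \<longrightarrow> subgraph (with_proj H) (with_proj G) \<longrightarrow> H \<noteq> G \<longrightarrow>
        tree_depth H < tree_depth G)"

definition delete_vertex :: "'a pair_pre_digraph \<Rightarrow> 'a \<Rightarrow> 'a pair_pre_digraph" where
  "delete_vertex G v =
     \<lparr> pverts = pverts G - {v}, parcs = {(x, y) \<in> parcs G. x \<noteq> v \<and> y \<noteq> v} \<rparr>"

definition delete_edge :: "'a pair_pre_digraph \<Rightarrow> 'a \<Rightarrow> 'a \<Rightarrow> 'a pair_pre_digraph" where
  "delete_edge G u v = \<lparr> pverts = pverts G, parcs = parcs G - {(u, v), (v, u)} \<rparr>"

text \<open>
  The vertex resulting from the contraction of the edge \<open>uv\<close> is again called \<open>u\<close>. The loop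
  arising from the edge is dropped; parallel edges are identified since arcs form a set.
\<close>

definition contract_edge :: "'a pair_pre_digraph \<Rightarrow> 'a \<Rightarrow> 'a \<Rightarrow> 'a pair_pre_digraph" where
  "contract_edge G u v =
     (let r = id(v := u) in
      \<lparr> pverts = r ` pverts G, parcs = {(r x, r y) | x y. (x, y) \<in> parcs G \<and> r x \<noteq> r y} \<rparr>)"

inductive minor_step :: "'a pair_pre_digraph \<Rightarrow> 'a pair_pre_digraph \<Rightarrow> bool" where
  vertex_deletion: "v \<in> pverts G \<Longrightarrow> minor_step G (delete_vertex G v)"
| edge_deletion: "(u, v) \<in> parcs G \<Longrightarrow> minor_step G (delete_edge G u v)"
| edge_contraction: "(u, v) \<in> parcs G \<Longrightarrow> minor_step G (contract_edge G u v)"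

text \<open>
  Minors are taken up to isomorphism. At least one step is required, and each step decreases the
  number of vertices plus the number of edges; so no finite graph is a proper minor of itself.
\<close>

definition proper_minor :: "'b pair_pre_digraph \<Rightarrow> 'a pair_pre_digraph \<Rightarrow> bool" where
  "proper_minor H G \<longleftrightarrow>
     (\<exists>H'. minor_step\<^sup>+\<^sup>+ G H' \<and> digraph_iso (with_proj H') (with_proj H))"

text \<open>
  Letting \<open>H\<close> range over graphs with the vertex type of \<open>G\<close> is no restriction: up to isomorphism
  all minors of \<open>G\<close> live on subsets of \<^term>\<open>pverts G\<close>.
\<close>

definition critical :: "nat \<Rightarrow> 'a pair_pre_digraph \<Rightarrow> bool" where
  "critical k G \<longleftrightarrow>
     tree_depth G = k \<and>
     (\<forall>H :: 'a pair_pre_digraph. proper_minor H G \<longrightarrow> tree_depth H < k)"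

end

theory Submission
  imports Defs
begin

text \<open>
  Let \<open>G\<close> be 1-unique and subgraph-critical. Tree-depth does not increase under minor steps, so it
  is enough that the first step away from \<open>G\<close> lowers it. Deletions yield proper
  subgraphs. For the contraction of an edge \<open>uv\<close>, take an optimal ranking \<open>f\<close> in which \<open>v\<close> is the only
  vertex with label 1. Every edge of the contraction that is not an edge of \<open>G\<close> joins \<open>u\<close> to some
  neighbour \<open>w\<close> of \<open>v\<close>, hence can be replaced by the path \<open>u, v, w\<close> of \<open>G\<close>, whose inner vertex
  has the least label. So any path of the contraction can be rerouted in \<open>G\<close> without meeting a
  larger label, and \<open>f - 1\<close> is a ranking of the contraction with one label less.

  All comparisons of tree-depths rest on the same rerouting argument
  (\<open>is_ranking_pullback\<close>): a ranking of \<open>G\<close> can be pulled back along an injection \<open>r\<close> from the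
  vertices of \<open>H\<close>, and lowered by a constant that leaves the labels positive, if every edge \<open>ab\<close>
  of \<open>H\<close> can be replaced by a walk of \<open>G\<close> from \<open>r a\<close> to \<open>r b\<close> on which no label exceeds the
  larger label of the two ends. To have walks at one's disposal instead of paths, rankings are first
  described by reachability: two vertices of the same label \<open>c\<close> are never connected in the subgraph
  on the vertices with labels up to \<open>c\<close>.
\<close>

section \<open>Rankings in terms of reachability\<close>

definition sublevel :: "'a pair_pre_digraph \<Rightarrow> ('a \<Rightarrow> nat) \<Rightarrow> nat \<Rightarrow> 'a pair_pre_digraph" where
  "sublevel G f c =
     \<lparr> pverts = {v \<in> pverts G. f v \<le> c}, parcs = {(x, y) \<in> parcs G. f x \<le> c \<and> f y \<le> c} \<rparr>"

lemma sublevel_simps [simp]: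
  "pverts (sublevel G f c) = {v \<in> pverts G. f v \<le> c}"
  "parcs (sublevel G f c) = {(x, y) \<in> parcs G. f x \<le> c \<and> f y \<le> c}"
  by (simp_all add: sublevel_def)

lemma pair_wf_digraph_sublevel:
  assumes "pair_wf_digraph G"
  shows "pair_wf_digraph (sublevel G f c)"
  using assms by (auto simp: pair_wf_digraph_def)

lemma wf_digraph_with_proj:
  assumes "pair_wf_digraph G"
  shows "wf_digraph (with_proj G)"
  using assms by (auto simp: pair_wf_digraph_def wf_digraph_def)

lemma vwalk_arcs_subset_vertices:
  assumes "(x, y) \<in> set (vwalk_arcs p)"
  shows "x \<in> set p \<and> y \<in> set p"
  using assms by (induction p rule: vwalk_arcs.induct) auto

lemma vpath_sublevel_iff:
  "vpath p (with_proj (sublevel G f c)) \<longleftrightarrow> vpath p (with_proj G) \<and> (\<forall>w \<in> set p. f w \<le> c)"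
  using vwalk_arcs_subset_vertices[of _ _ p] unfolding vpath_def vwalk_def by fastforce

lemma reachable_sublevel_mono:
  assumes "x \<rightarrow>\<^sup>*\<^bsub>with_proj (sublevel G f c)\<^esub> y" "c \<le> d"
  shows "x \<rightarrow>\<^sup>*\<^bsub>with_proj (sublevel G f d)\<^esub> y"
  unfolding reachable_def
  by (rule rtrancl_on_mono[OF _ _ assms(1)[unfolded reachable_def]]) (use assms(2) in auto)

lemma reachable_sublevel_arc:
  assumes "pair_wf_digraph G" "(x, y) \<in> parcs G" "f x \<le> c" "f y \<le> c"
  shows "x \<rightarrow>\<^sup>*\<^bsub>with_proj (sublevel G f c)\<^esub> y"
proof -
  interpret pair_wf_digraph "sublevel G f c"
    using assms(1) by (rule pair_wf_digraph_sublevel)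
  show ?thesis
    using assms(2-4) by (intro reachable_adjI) simp
qed

lemma is_ranking_iff_reachable:
  assumes "pair_wf_digraph G"
  shows "is_ranking G k f \<longleftrightarrow>
    (\<forall>v \<in> pverts G. f v \<in> {1..k}) \<and>
    (\<forall>x y. f x = f y \<longrightarrow> x \<rightarrow>\<^sup>*\<^bsub>with_proj (sublevel G f (f x))\<^esub> y \<longrightarrow> x = y)"
proof -
  have path: "(x \<rightarrow>\<^sup>*\<^bsub>with_proj (sublevel G f c)\<^esub> y) \<longleftrightarrow>
      (\<exists>p. vpath p (with_proj G) \<and> (\<forall>w \<in> set p. f w \<le> c) \<and> hd p = x \<and> last p = y)" for x y c
    using wf_digraph.reachable_vpath_conv
        [OF wf_digraph_with_proj[OF pair_wf_digraph_sublevel[OF assms]]]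
    by (auto simp: vpath_sublevel_iff)
  show ?thesis
    unfolding is_ranking_def path not_le[symmetric] by blast
qed

section \<open>Pulling back rankings\<close>

text \<open>
  A walk in a sublevel graph of \<open>H\<close> is mapped to a walk in the sublevel graph of \<open>G\<close> at the level
  raised by \<open>s\<close>, as the walks that replace its edges stay in the latter; and \<open>r\<close> keeps
  distinct ends distinct.
\<close>

lemma is_ranking_pullback:
  assumes G: "pair_wf_digraph G" and H: "pair_wf_digraph H"
    and rank: "is_ranking G (k + s) f"
    and inj: "inj_on r (pverts H)"
    and sub: "r ` pverts H \<subseteq> pverts G"
    and large: "\<And>v. v \<in> pverts H \<Longrightarrow> s < f (r v)"
    and reroute: "\<And>a b. (a, b) \<in> parcs H \<Longrightarrow>
      r a \<rightarrow>\<^sup>*\<^bsub>with_proj (sublevel G f (max (f (r a)) (f (r b))))\<^esub> r b"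
  shows "is_ranking H k (\<lambda>v. f (r v) - s)"
proof -
  let ?g = "\<lambda>v. f (r v) - s"
  have range: "?g v \<in> {1..k}" if "v \<in> pverts H" for v
  proof -
    have "f (r v) \<in> {1..k + s}"
      using rank sub that unfolding is_ranking_def by blast
    then show ?thesis
      using large[OF that] by auto
  qed
  have walk: "r x \<rightarrow>\<^sup>*\<^bsub>with_proj (sublevel G f (c + s))\<^esub> r y"
    if "x \<rightarrow>\<^sup>*\<^bsub>with_proj (sublevel H ?g c)\<^esub> y" for x y c
  proof -
    interpret G': pair_wf_digraph "sublevel G f (c + s)"
      using G by (rule pair_wf_digraph_sublevel)
    show ?thesis
      using that unfolding reachable_def[of "with_proj (sublevel H ?g c)"]
    proof (induction rule: rtrancl_on_induct)
      case base
      then show ?case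
        using sub by auto
    next
      case (step y z)
      then have "r y \<rightarrow>\<^sup>*\<^bsub>with_proj (sublevel G f (c + s))\<^esub> r z"
        by (intro reachable_sublevel_mono[OF reroute]) auto
      with step.IH show ?case
        by (rule G'.reachable_trans)
    qed
  qed
  have "x = y" if eq: "?g x = ?g y" and xy: "x \<rightarrow>\<^sup>*\<^bsub>with_proj (sublevel H ?g (?g x))\<^esub> y" for x y
  proof -
    interpret H': pair_wf_digraph "sublevel H ?g (?g x)"
      using H by (rule pair_wf_digraph_sublevel)
    have x: "x \<in> pverts H" and y: "y \<in> pverts H"
      using H'.reachable_in_verts[OF xy] by auto
    have level: "?g x + s = f (r x)" and same: "f (r x) = f (r y)"
      using large[OF x] large[OF y] eq by auto
    have "r x \<rightarrow>\<^sup>*\<^bsub>with_proj (sublevel G f (f (r x)))\<^esub> r y"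
      using walk[OF xy] level by simp
    then have "r x = r y"
      using rank same unfolding is_ranking_iff_reachable[OF G] by blast
    then show ?thesis
      using inj x y by (auto dest: inj_onD)
  qed
  with range show ?thesis
    unfolding is_ranking_iff_reachable[OF H] by blast
qed

lemma is_ranking_subgraph:
  assumes "pair_wf_digraph G" "pair_wf_digraph H" "is_ranking G k f"
    and "pverts H \<subseteq> pverts G" "parcs H \<subseteq> parcs G"
  shows "is_ranking H k f"
proof -
  have "is_ranking H k (\<lambda>v. f (id v) - 0)"
  proof (rule is_ranking_pullback[OF assms(1,2)])
    show "0 < f (id v)" if "v \<in> pverts H" for v
    proof -
      have "f v \<in> {1..k}"
        using assms(3,4) that unfolding is_ranking_def by blast
      then show ?thesis by simp
    qed
  qed (use assms in \<open>auto intro!: reachable_sublevel_arc\<close>)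
  then show ?thesis by simp
qed

section \<open>Tree-depth\<close>

lemma tree_depth_le:
  assumes "is_ranking G k f"
  shows "tree_depth G \<le> k"
  unfolding tree_depth_def using assms by (intro Least_le) blast

lemma optimal_ranking_exists:
  assumes "finite (pverts G)"
  shows "\<exists>f. optimal_ranking G f"
proof -
  obtain h :: "_ \<Rightarrow> nat" and n where h: "h ` pverts G = {i. i < n}" "inj_on h (pverts G)"
    using finite_imp_inj_to_nat_seg[OF assms] by blast
  \<comment> \<open>Distinct labels make the condition on paths vacuous; labels start at 1.\<close>
  have "is_ranking G n (\<lambda>v. h v + 1)"
    unfolding is_ranking_def
  proof (intro conjI ballI allI impI)
    fix v assume "v \<in> pverts G"
    then have "h v < n" using h(1) by blast
    then show "h v + 1 \<in> {1..n}" by simp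
  next
    fix p assume p: "vpath p (with_proj G)" "hd p \<noteq> last p" "h (hd p) + 1 = h (last p) + 1"
    then have "hd p \<in> pverts G" "last p \<in> pverts G"
      by (auto simp: vpath_def vwalk_def)
    with p h(2) show "\<exists>w \<in> set p. h (hd p) + 1 < h w + 1"
      by (auto dest: inj_onD)
  qed
  then show ?thesis
    unfolding optimal_ranking_def tree_depth_def
    using LeastI[of "\<lambda>k. \<exists>f. is_ranking G k f" n] by blast
qed

lemma tree_depth_iso_le:
  assumes G: "pair_wf_digraph G" "finite (pverts G)"
    and "digraph_iso (with_proj G) (with_proj H)"
  shows "tree_depth H \<le> tree_depth G"
proof -
  obtain hom where hom: "pre_digraph.digraph_isomorphism (with_proj G) hom"
    and H_eq: "with_proj H = app_iso hom (with_proj G)"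
    using assms(3) unfolding digraph_iso_def by blast
  let ?h = "iso_verts hom" and ?r = "inv_into (pverts G) (iso_verts hom)"
  have inj: "inj_on ?h (pverts G)"
    using hom by (simp add: pre_digraph.digraph_isomorphism_def)
  have verts: "pverts H = ?h ` pverts G"
    using arg_cong[OF H_eq, of verts] by simp
  have arc: "\<exists>x y. (x, y) \<in> parcs G \<and> a = ?h x \<and> b = ?h y" if "(a, b) \<in> parcs H" for a b
  proof -
    have parcs: "parcs H = iso_arcs hom ` parcs G" and proj: "iso_tail hom = fst" "iso_head hom = snd"
      using arg_cong[OF H_eq, of arcs] arg_cong[OF H_eq, of tail] arg_cong[OF H_eq, of head]
      by simp_all
    have "(a, b) \<in> iso_arcs hom ` parcs G"
      using that parcs by simp
    then obtain e where e: "iso_arcs hom e = (a, b)" "e \<in> parcs G"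
      by (metis imageE)
    with hom have "?h (fst e) = a" "?h (snd e) = b"
      using proj by (auto simp: pre_digraph.digraph_isomorphism_def)
    with e(2) show ?thesis
      by (intro exI[of _ "fst e"] exI[of _ "snd e"]) simp
  qed
  have in_G: "x \<in> pverts G" "y \<in> pverts G" if "(x, y) \<in> parcs G" for x y
    using G(1) that by (auto simp: pair_wf_digraph_def)
  have H: "pair_wf_digraph H"
  proof
    show "fst e \<in> pverts H" "snd e \<in> pverts H" if e: "e \<in> parcs H" for e
    proof -
      have "(fst e, snd e) \<in> parcs H"
        using e by simp
      then obtain x y where "(x, y) \<in> parcs G" "fst e = ?h x" "snd e = ?h y"
        using arc by blast
      then show "fst e \<in> pverts H" "snd e \<in> pverts H"
        using in_G unfolding verts by auto
    qed
  qed
  obtain f where f: "is_ranking G (tree_depth G) f"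
    using optimal_ranking_exists[OF G(2)] unfolding optimal_ranking_def by blast
  have "is_ranking H (tree_depth G) (\<lambda>v. f (?r v) - 0)"
  proof (rule is_ranking_pullback[OF G(1) H])
    show "inj_on ?r (pverts H)"
      unfolding verts by (rule inj_on_inv_into) simp
    show sub: "?r ` pverts H \<subseteq> pverts G"
      using inj by (auto simp: verts)
    show "0 < f (?r v)" if "v \<in> pverts H" for v
    proof -
      have "f (?r v) \<in> {1..tree_depth G}"
        using f sub that unfolding is_ranking_def by blast
      then show ?thesis by simp
    qed
    show "?r a \<rightarrow>\<^sup>*\<^bsub>with_proj (sublevel G f (max (f (?r a)) (f (?r b))))\<^esub> ?r b"
      if ab: "(a, b) \<in> parcs H" for a b
    proof -
      obtain x y where xy: "(x, y) \<in> parcs G" "a = ?h x" "b = ?h y"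
        using arc[OF ab] by blast
      then have "?r a = x" "?r b = y"
        using in_G inj by auto
      then show ?thesis
        using xy(1) by (auto intro!: reachable_sublevel_arc G(1))
    qed
  qed (use f in simp)
  then show ?thesis by (rule tree_depth_le)
qed

section \<open>Minor steps\<close>

lemma pair_graph_arcD:
  assumes "pair_graph G" "(u, v) \<in> parcs G"
  shows "u \<in> pverts G" "v \<in> pverts G" "u \<noteq> v" "(v, u) \<in> parcs G"
proof -
  interpret pair_graph G by fact
  show "u \<in> pverts G" "v \<in> pverts G" "(v, u) \<in> parcs G"
    using assms(2) in_arcsD1 in_arcsD2 arcs_symmetric by auto
  show "u \<noteq> v"
    using pair_no_loops[OF assms(2)] by simp
qed

lemma pair_graphI:
  assumes "finite (pverts G)" "parcs G \<subseteq> pverts G \<times> pverts G"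
    and "sym (parcs G)" "irrefl (parcs G)"
  shows "pair_graph G"
proof
  show "finite (parcs G)"
    using assms(1,2) finite_subset by blast
  show "symmetric (with_proj G)"
    using assms(3) by (simp add: symmetric_def)
qed (use assms in \<open>auto simp: irrefl_def\<close>)

lemma pair_graphD:
  assumes "pair_graph G"
  shows "finite (pverts G)" "parcs G \<subseteq> pverts G \<times> pverts G" "sym (parcs G)" "irrefl (parcs G)"
    "pair_wf_digraph G"
proof -
  interpret pair_graph G by fact
  show "finite (pverts G)" by (rule pair_finite_verts)
  show "pair_wf_digraph G" by unfold_locales
  show "parcs G \<subseteq> pverts G \<times> pverts G" "sym (parcs G)" "irrefl (parcs G)"
    using pair_graph_arcD[OF assms] by (auto simp: irrefl_def intro!: symI) blast
qed

lemma pair_graph_delete_vertex: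
  assumes "pair_graph G"
  shows "pair_graph (delete_vertex G v)"
  using pair_graphD[OF assms]
  by (intro pair_graphI) (auto simp: delete_vertex_def irrefl_def intro!: symI dest: symD)

lemma pair_graph_delete_edge:
  assumes "pair_graph G"
  shows "pair_graph (delete_edge G u v)"
  using pair_graphD[OF assms]
  by (intro pair_graphI) (auto simp: delete_edge_def irrefl_def intro!: symI dest: symD)

lemma contract_edge_simps:
  "pverts (contract_edge G u v) = (id(v := u)) ` pverts G"
  "parcs (contract_edge G u v) =
     {((id(v := u)) x, (id(v := u)) y) | x y. (x, y) \<in> parcs G \<and> (id(v := u)) x \<noteq> (id(v := u)) y}"
  by (simp_all only: contract_edge_def Let_def pair_pre_digraph.simps)

lemma pverts_contract_edge:
  assumes "pair_graph G" "(u, v) \<in> parcs G"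
  shows "pverts (contract_edge G u v) = pverts G - {v}"
  using pair_graph_arcD[OF assms] unfolding contract_edge_simps(1)
  by (auto simp: image_iff)

lemma pair_graph_contract_edge:
  assumes "pair_graph G"
  shows "pair_graph (contract_edge G u v)"
proof (rule pair_graphI)
  show "finite (pverts (contract_edge G u v))"
    using pair_graphD(1)[OF assms] unfolding contract_edge_simps by simp
  show "parcs (contract_edge G u v) \<subseteq> pverts (contract_edge G u v) \<times> pverts (contract_edge G u v)"
    using pair_graphD(2)[OF assms] unfolding contract_edge_simps by blast
  show "sym (parcs (contract_edge G u v))"
  proof (rule symI)
    fix a b assume "(a, b) \<in> parcs (contract_edge G u v)"
    then obtain x y where xy: "(x, y) \<in> parcs G" "a = (id(v := u)) x" "b = (id(v := u)) y" "a \<noteq> b"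
      unfolding contract_edge_simps by blast
    have "(y, x) \<in> parcs G"
      using pair_graphD(3)[OF assms] xy(1) by (rule symD)
    with xy(2-4) show "(b, a) \<in> parcs (contract_edge G u v)"
      unfolding contract_edge_simps mem_Collect_eq by metis
  qed
  show "irrefl (parcs (contract_edge G u v))"
    unfolding contract_edge_simps irrefl_def by blast
qed

lemma pair_graph_minor_step:
  assumes "minor_step G H" "pair_graph G"
  shows "pair_graph H"
  using assms
  by cases (simp_all add: pair_graph_delete_vertex pair_graph_delete_edge pair_graph_contract_edge)

text \<open>
  The merged vertex is represented by the end of \<open>uv\<close> with the larger label. Within the level of
  that label the other end is adjacent to it, so the representative takes over its edges as well.
\<close>

lemma is_ranking_contract_edge:
  assumes G: "pair_graph G" and uv: "(u, v) \<in> parcs G" and rank: "is_ranking G k f"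
  shows "\<exists>g. is_ranking (contract_edge G u v) k g"
proof -
  define q where "q = id(v := u)"
  define r where "r = (\<lambda>x. if x = u \<and> f u < f v then v else x)"
  note wf = pair_graphD(5)[OF G]
  note ends = pair_graph_arcD[OF G uv]
  note verts = pverts_contract_edge[OF G uv]
  have link: "(x \<rightarrow>\<^sup>*\<^bsub>with_proj (sublevel G f c)\<^esub> r (q x)) \<and>
      (r (q x) \<rightarrow>\<^sup>*\<^bsub>with_proj (sublevel G f c)\<^esub> x) \<and> f x \<le> f (r (q x))"
    if x: "x \<in> pverts G" and c: "f (r (q x)) \<le> c" for x c
  proof -
    interpret S: pair_wf_digraph "sublevel G f c"
      using wf by (rule pair_wf_digraph_sublevel)
    consider "r (q x) = x"
      | "x = u" "r (q x) = v" "f u \<le> f v"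
      | "x = v" "r (q x) = u" "f v \<le> f u"
      using ends(3) unfolding r_def q_def
      by (cases "x = v"; cases "x = u"; cases "f u < f v") auto
    then show ?thesis
    proof cases
      case 1
      with x c show ?thesis by simp
    next
      case 2
      show ?thesis
        using c 2(3) unfolding 2(2) unfolding 2(1)
        by (auto intro!: reachable_sublevel_arc wf uv ends(4))
    next
      case 3
      show ?thesis
        using c 3(3) unfolding 3(2) unfolding 3(1)
        by (auto intro!: reachable_sublevel_arc wf uv ends(4))
    qed
  qed
  have "is_ranking (contract_edge G u v) k (\<lambda>x. f (r x) - 0)"
  proof (rule is_ranking_pullback[OF wf pair_graphD(5)[OF pair_graph_contract_edge[OF G]]])
    show "inj_on r (pverts (contract_edge G u v))"
      unfolding verts r_def by (rule inj_onI) (simp split: if_splits)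
    show sub: "r ` pverts (contract_edge G u v) \<subseteq> pverts G"
      unfolding verts r_def using ends(1,2) by auto
    show "0 < f (r x)" if "x \<in> pverts (contract_edge G u v)" for x
    proof -
      have "f (r x) \<in> {1..k}"
        using rank sub that unfolding is_ranking_def by blast
      then show ?thesis by simp
    qed
    show "r a \<rightarrow>\<^sup>*\<^bsub>with_proj (sublevel G f (max (f (r a)) (f (r b))))\<^esub> r b"
      if ab: "(a, b) \<in> parcs (contract_edge G u v)" for a b
    proof -
      obtain x y where xy: "(x, y) \<in> parcs G" and a: "a = q x" and b: "b = q y"
        using ab unfolding contract_edge_simps q_def by blast
      let ?c = "max (f (r a)) (f (r b))"
      interpret S: pair_wf_digraph "sublevel G f ?c"
        using wf by (rule pair_wf_digraph_sublevel)
      have x: "r a \<rightarrow>\<^sup>*\<^bsub>with_proj (sublevel G f ?c)\<^esub> x" "f x \<le> ?c"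
        using link[OF pair_graph_arcD(1)[OF G xy], of ?c] by (simp_all add: a le_max_iff_disj)
      have y: "y \<rightarrow>\<^sup>*\<^bsub>with_proj (sublevel G f ?c)\<^esub> r b" "f y \<le> ?c"
        using link[OF pair_graph_arcD(2)[OF G xy], of ?c] by (simp_all add: b le_max_iff_disj)
      have "x \<rightarrow>\<^sup>*\<^bsub>with_proj (sublevel G f ?c)\<^esub> y"
        using x(2) y(2) by (rule reachable_sublevel_arc[OF wf xy])
      with x(1) show ?thesis
        using y(1) S.reachable_trans by blast
    qed
  qed (use rank in simp)
  then show ?thesis by blast
qed

text \<open>
  Here the merged vertex is represented by \<open>u\<close>: the edges it inherits from \<open>v\<close> are replaced
  by detours through \<open>v\<close>, which lies in every nonempty sublevel graph.
\<close>

lemma is_ranking_contract_edge_unique_one: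
  assumes G: "pair_graph G" and uv: "(u, v) \<in> parcs G"
    and rank: "is_ranking G (k + 1) f" and unique: "{x \<in> pverts G. f x = 1} = {v}"
  shows "is_ranking (contract_edge G u v) k (\<lambda>x. f x - 1)"
proof -
  let ?q = "id(v := u)"
  note wf = pair_graphD(5)[OF G]
  note ends = pair_graph_arcD[OF G uv]
  note verts = pverts_contract_edge[OF G uv]
  have pos: "1 \<le> f x" if "x \<in> pverts G" for x
    using rank that unfolding is_ranking_def by auto
  have fv: "f v = 1"
    using unique by blast
  have "is_ranking (contract_edge G u v) k (\<lambda>x. f (id x) - 1)"
  proof (rule is_ranking_pullback[OF wf pair_graphD(5)[OF pair_graph_contract_edge[OF G]] rank])
    show "inj_on id (pverts (contract_edge G u v))"
      by simp
    show "id ` pverts (contract_edge G u v) \<subseteq> pverts G"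
      unfolding verts by auto
    show "1 < f (id x)" if "x \<in> pverts (contract_edge G u v)" for x
    proof -
      have "x \<in> pverts G" "f x \<noteq> 1"
        using that unique unfolding verts by auto
      then show ?thesis
        using pos[of x] by simp
    qed
    show "id a \<rightarrow>\<^sup>*\<^bsub>with_proj (sublevel G f (max (f (id a)) (f (id b))))\<^esub> id b"
      if ab: "(a, b) \<in> parcs (contract_edge G u v)" for a b
    proof -
      obtain x y where xy: "(x, y) \<in> parcs G" and a: "a = ?q x" and b: "b = ?q y"
        using ab unfolding contract_edge_simps by blast
      let ?c = "max (f a) (f b)"
      interpret S: pair_wf_digraph "sublevel G f ?c"
        using wf by (rule pair_wf_digraph_sublevel)
      have in_G: "a \<in> pverts G" "b \<in> pverts G"
        using ends(1) pair_graph_arcD[OF G xy] by (auto simp: a b)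
      have fv_le: "f v \<le> ?c"
        using pos[OF in_G(1)] fv by simp
      have "a \<rightarrow>\<^sup>*\<^bsub>with_proj (sublevel G f ?c)\<^esub> x"
      proof (cases "x = v")
        case True
        then have "a = u" by (simp add: a)
        then show ?thesis
          using True fv_le by (auto intro!: reachable_sublevel_arc wf uv)
      next
        case False
        then have "x = a" by (simp add: a)
        then show ?thesis using in_G(1) by simp
      qed
      moreover have "x \<rightarrow>\<^sup>*\<^bsub>with_proj (sublevel G f ?c)\<^esub> y"
        using fv_le by (intro reachable_sublevel_arc wf xy) (auto simp: a b)
      moreover have "y \<rightarrow>\<^sup>*\<^bsub>with_proj (sublevel G f ?c)\<^esub> b"
      proof (cases "y = v")
        case True
        then have "b = u" by (simp add: b)
        then show ?thesis
          using True fv_le by (auto intro!: reachable_sublevel_arc wf ends(4))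
      next
        case False
        then have "y = b" by (simp add: b)
        then show ?thesis using in_G(2) by simp
      qed
      ultimately show ?thesis
        by (auto intro: S.reachable_trans)
    qed
  qed
  then show ?thesis by simp
qed

lemma tree_depth_minor_step_le:
  assumes step: "minor_step G H" and G: "pair_graph G"
  shows "tree_depth H \<le> tree_depth G"
proof -
  note wf = pair_graphD(5)[OF G] pair_graphD(5)[OF pair_graph_minor_step[OF assms]]
  obtain f where f: "is_ranking G (tree_depth G) f"
    using optimal_ranking_exists[OF pair_graphD(1)[OF G]] unfolding optimal_ranking_def by blast
  from step have "\<exists>g. is_ranking H (tree_depth G) g"
  proof cases
    case vertex_deletion
    then show ?thesis
      using is_ranking_subgraph[OF wf f] by (auto simp: delete_vertex_def)
  next
    case edge_deletion
    then show ?thesis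
      using is_ranking_subgraph[OF wf f] by (auto simp: delete_edge_def)
  next
    case edge_contraction
    then show ?thesis
      using is_ranking_contract_edge[OF G _ f] by blast
  qed
  then show ?thesis
    using tree_depth_le by blast
qed

lemma tree_depth_minor_steps_le:
  assumes "minor_step\<^sup>*\<^sup>* G H" "pair_graph G"
  shows "pair_graph H \<and> tree_depth H \<le> tree_depth G"
  using assms
proof (induction rule: rtranclp_induct)
  case (step H K)
  then show ?case
    using pair_graph_minor_step tree_depth_minor_step_le le_trans by blast
qed simp

lemma tree_depth_minor_step_less:
  assumes step: "minor_step G H" and G: "pair_graph G"
    and unique: "one_unique G" and crit: "subgraph_critical G" and depth: "tree_depth G = k + 1"
  shows "tree_depth H < tree_depth G"
proof -
  note H = pair_graph_minor_step[OF step G]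
  note wf = pair_graphD(5)[OF G] pair_graphD(5)[OF H]
  have proper: "tree_depth H < tree_depth G"
    if "pverts H \<subseteq> pverts G" "parcs H \<subseteq> parcs G" "H \<noteq> G"
  proof -
    have "subgraph (with_proj H) (with_proj G)"
      using that wf by (simp add: subgraph_def compatible_def wf_digraph_with_proj)
    then show ?thesis
      using crit H that(3) unfolding subgraph_critical_def by blast
  qed
  from step show ?thesis
  proof cases
    case (vertex_deletion v)
    then have "v \<notin> pverts H"
      by (simp add: delete_vertex_def)
    with vertex_deletion(2) have "H \<noteq> G"
      by blast
    then show ?thesis
      by (rule proper[rotated 2]) (auto simp: vertex_deletion(1) delete_vertex_def)
  next
    case (edge_deletion u v)
    then have "(u, v) \<notin> parcs H"
      by (simp add: delete_edge_def)
    with edge_deletion(2) have "H \<noteq> G"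
      by blast
    then show ?thesis
      by (rule proper[rotated 2]) (auto simp: edge_deletion(1) delete_edge_def)
  next
    case (edge_contraction u v)
    obtain f where "is_ranking G (k + 1) f" "{x \<in> pverts G. f x = 1} = {v}"
      using unique pair_graph_arcD(2)[OF G edge_contraction(2)] depth
      unfolding one_unique_def optimal_ranking_def by metis
    then have "is_ranking H k (\<lambda>x. f x - 1)"
      using is_ranking_contract_edge_unique_one[OF G edge_contraction(2)] edge_contraction(1)
      by blast
    then show ?thesis
      using tree_depth_le depth by fastforce
  qed
qed

theorem theorem2p4:
  fixes G :: "'a pair_pre_digraph" and k :: nat
  assumes "pair_graph G"
    and "one_unique G"
    and "subgraph_critical G"
    and "tree_depth G = k + 1"
  shows "critical (k + 1) G"
  unfolding critical_def
proof (intro conjI allI impI)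
  show "tree_depth G = k + 1" by fact
next
  fix H :: "'a pair_pre_digraph"
  assume "proper_minor H G"
  then obtain H' where steps: "minor_step\<^sup>+\<^sup>+ G H'"
    and iso: "digraph_iso (with_proj H') (with_proj H)"
    unfolding proper_minor_def by blast
  obtain G' where first: "minor_step G G'" and rest: "minor_step\<^sup>*\<^sup>* G' H'"
    using tranclpD[OF steps] by blast
  have H': "pair_graph H'" "tree_depth H' \<le> tree_depth G'"
    using tree_depth_minor_steps_le[OF rest pair_graph_minor_step[OF first assms(1)]] by auto
  have "tree_depth H \<le> tree_depth H'"
    using tree_depth_iso_le[OF pair_graphD(5,1)[OF H'(1)] iso] .
  also have "\<dots> \<le> tree_depth G'"
    by (rule H'(2))
  also have "\<dots> < tree_depth G"
    by (rule tree_depth_minor_step_less[OF first assms])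
  finally show "tree_depth H < k + 1"
    using assms(4) by simp
qed

end
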